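(* Let $\Lambda\subset\mathbb{N}_0^d$ be a lower set, $n\in\mathbb{N}$, and $\mathbf{z}\in\mathbb{Z}^d$. The following statements are equivalent: (i) $(n,\mathbf{z})$ is admissible for Plan B for $\Lambda$; (ii) $(n,\mathbf{z})$ is admissible for Plan C for $\Lambda$ and $2\,\mathbf{h}\cdot\mathbf{z}\not\equiv_n 0$ for all $\mathbf{h}\in\mathcal{E}(\Lambda)\setminus\{\mathbf{0}\}$. Moreover, if $n$ is odd, the additional condition $2\,\mathbf{h}\cdot\mathbf{z}\not\equiv_n0$ in (ii) is not required, i.e. admissibility for Plan B for $\Lambda$ is equivalent to admissibility for Plan C for $\Lambda$.
   Context: $\mathbb{N}=\{1,2,\dots\}$, $\mathbb{N}_0=\mathbb{N}\cup\{0\}$; $a\equiv_n b$ means $a\equiv b\pmod n$. A set $\Lambda\subset\mathbb{N}_0^d$ is lower if $\mathbf{k}\in\Lambda$ and $\mathbf{h}\in\mathbb{N}_0^d$ with $\mathbf{h}\le\mathbf{k}$ (component-wise) imply $\mathbf{h}\in\Lambda$. An element $\mathbf{k}\in\Lambda$ is extremal if $2\mathbf{k}=\mathbf{h}+\mathbf{h}'$ with $\mathbf{h},\mathbf{h}'\in\Lambda$ implies $\mathbf{h}=\mathbf{h}'=\mathbf{k}$; $\mathcal{E}(\Lambda)$ is the set of extremal elements of $\Lambda$. For $\mathbf{h}\in\mathbb{N}_0^d$, $\mathcal{S}_{\mathbf{h}}$ is the set of the $2^{|\mathbf{h}|_0}$ component-wise sign changes acting on the nonzero coordinates of $\mathbf{h}$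 (including the identity), where $|\mathbf{h}|_0$ is the number of nonzero coordinates. A pair $(n,\mathbf{z})\in\mathbb{N}\times\mathbb{Z}^d$ is, for $\Lambda$: - admissible for Plan B if $\sigma(\mathbf{h})\cdot\mathbf{z}\not\equiv_n\mathbf{h}'\cdot\mathbf{z}$ for all $\mathbf{h},\mathbf{h}'\in\Lambda$ and $\sigma\in\mathcal{S}_{\mathbf{h}}$ with $\sigma(\mathbf{h})\ne\mathbf{h}'$; - admissible for Plan C if $\sigma(\mathbf{h})\cdot\mathbf{z}\not\equiv_n\mathbf{h}'\cdot\mathbf{z}$ for all $\mathbf{h},\mathbf{h}'\in\Lambda$ and $\sigma\in\mathcal{S}_{\mathbf{h}}$ with $\mathbf{h}\ne\mathbf{h}'$. *)

theory Defs
  imports "HOL-Analysis.Analysis" "HOL-Number_Theory.Cong"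
begin

(* The order on nat ^ 'd is the library's component-wise order. *)
definition lower_set :: "(nat ^ 'd) set \<Rightarrow> bool" where
  "lower_set \<Lambda> \<longleftrightarrow> (\<forall>k\<in>\<Lambda>. \<forall>h. h \<le> k \<longrightarrow> h \<in> \<Lambda>)"

definition extremal_elements :: "(nat ^ 'd) set \<Rightarrow> (nat ^ 'd) set" where
  "extremal_elements \<Lambda> =
     {k \<in> \<Lambda>. \<forall>h\<in>\<Lambda>. \<forall>h'\<in>\<Lambda>. 2 *s k = h + h' \<longrightarrow> h = k \<and> h' = k}"

definition int_vec :: "nat ^ 'd \<Rightarrow> int ^ 'd" where
  "int_vec h = (\<chi> i. int (h $ i))"

(* The library's inner product is only available over the reals. *)
definition int_dot :: "int ^ 'd \<Rightarrow> int ^ 'd \<Rightarrow> int" where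
  "int_dot x y = (\<Sum>i\<in>UNIV. x $ i * y $ i)"

definition sign_change :: "'d set \<Rightarrow> int ^ 'd \<Rightarrow> int ^ 'd" where
  "sign_change J x = (\<chi> i. if i \<in> J then - (x $ i) else x $ i)"

(* A sign change is a map on int ^ 'd. Distinct J give distinct maps, so this set
   has 2 to the power of the number of nonzero coordinates of h elements. *)
definition sign_changes :: "nat ^ 'd \<Rightarrow> (int ^ 'd \<Rightarrow> int ^ 'd) set" where
  "sign_changes h = sign_change ` Pow {i. h $ i \<noteq> 0}"

definition admissible_plan_B :: "(nat ^ 'd) set \<Rightarrow> nat \<times> (int ^ 'd) \<Rightarrow> bool" where
  "admissible_plan_B \<Lambda> = (\<lambda>(n, z).
     \<forall>h\<in>\<Lambda>. \<forall>h'\<in>\<Lambda>. \<forall>\<sigma>\<in>sign_changes h. \<sigma> (int_vec h) \<noteq> int_vec h' \<longrightarrow>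
       \<not> [int_dot (\<sigma> (int_vec h)) z = int_dot (int_vec h') z] (mod int n))"

definition admissible_plan_C :: "(nat ^ 'd) set \<Rightarrow> nat \<times> (int ^ 'd) \<Rightarrow> bool" where
  "admissible_plan_C \<Lambda> = (\<lambda>(n, z).
     \<forall>h\<in>\<Lambda>. \<forall>h'\<in>\<Lambda>. \<forall>\<sigma>\<in>sign_changes h. h \<noteq> h' \<longrightarrow>
       \<not> [int_dot (\<sigma> (int_vec h)) z = int_dot (int_vec h') z] (mod int n))"

end

(* Plan B asks for more than Plan C only when h = h'. There, a sign change on J yields
   a congruence for h if and only if 2 k . z = 0 (mod n) for the restriction k of h to J;
   this k lies in the lower set. So Plan B is Plan C together with 2 k . z \<noteq> 0 for all nonzero k.
   Under Plan C the last condition holds for non-extremal k: if 2 k = a + b with a \<noteq> b, then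
   2 k . z = 0 would give (-a) . z = b . z. For odd n the factor 2 can be cancelled, and k is
   then in conflict with 0. *)
theory Submission
  imports Defs
begin

lemma lower_set_zero_mem:
  assumes "lower_set \<Lambda>" and "k \<in> \<Lambda>"
  shows "0 \<in> \<Lambda>"
proof -
  have "0 \<le> k"
    by (simp add: less_eq_vec_def)
  then show ?thesis
    using assms unfolding lower_set_def by blast
qed

lemma int_dot_neg_left: "int_dot (- x) z = - int_dot x z"
  by (simp add: int_dot_def sum_negf)

lemma int_dot_int_vec_add:
  "int_dot (int_vec (a + b)) z = int_dot (int_vec a) z + int_dot (int_vec b) z"
  by (simp add: int_dot_def int_vec_def distrib_right sum.distrib)

lemma int_dot_int_vec_zero [simp]: "int_dot (int_vec 0) z = 0"
  by (simp add: int_dot_def int_vec_def)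

lemma int_dot_int_vec_twice:
  "int_dot (int_vec (2 *s k)) z = 2 * int_dot (int_vec k) z"
  by (simp add: int_dot_def int_vec_def sum_distrib_left mult.assoc)

text \<open>Flipping the sign of one coordinate subtracts its term twice. Collecting the flipped
  terms in the restriction of \<open>h\<close> to \<open>J\<close> keeps the correction a vector of
  naturals below \<open>h\<close>, so it stays inside a lower set.\<close>

lemma int_dot_sign_change:
  "int_dot (sign_change J (int_vec h)) z =
     int_dot (int_vec h) z - 2 * int_dot (int_vec (\<chi> i. if i \<in> J then h $ i else 0)) z"
  unfolding int_dot_def sign_change_def int_vec_def sum_distrib_left sum_subtractf [symmetric]
  by (rule sum.cong) auto

text \<open>Flipping the whole support negates the vector, since the remaining coordinates are
  zero.\<close>

lemma uminus_sign_change: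
  obtains \<sigma> where "\<sigma> \<in> sign_changes h" and "\<sigma> (int_vec h) = - int_vec h"
proof
  show "sign_change {i. h $ i \<noteq> 0} \<in> sign_changes h"
    by (simp add: sign_changes_def)
  show "sign_change {i. h $ i \<noteq> 0} (int_vec h) = - int_vec h"
    by (simp add: sign_change_def int_vec_def vec_eq_iff)
qed

lemma id_mem_sign_changes: "id \<in> sign_changes h"
proof -
  have "sign_change {} = id"
    by (simp add: sign_change_def fun_eq_iff)
  then show ?thesis
    unfolding sign_changes_def by (metis Pow_bottom imageI)
qed

text \<open>Both vectors come from naturals, so a flipped coordinate can match only if both entries
  vanish.\<close>

lemma sign_change_eq_int_vecD:
  assumes "\<sigma> \<in> sign_changes h" and "\<sigma> (int_vec h) = int_vec h'"
  shows "h = h'"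
proof -
  from assms obtain J where "sign_change J (int_vec h) = int_vec h'"
    by (auto simp: sign_changes_def)
  then have eq: "sign_change J (int_vec h) $ i = int_vec h' $ i" for i
    by simp
  have "h $ i = h' $ i" for i
    using eq [of i] by (simp add: sign_change_def int_vec_def split: if_splits)
  then show ?thesis
    by (simp add: vec_eq_iff)
qed

lemma admissible_plan_BD:
  assumes "admissible_plan_B \<Lambda> (n, z)" and "h \<in> \<Lambda>" and "h' \<in> \<Lambda>"
    and "\<sigma> \<in> sign_changes h" and "\<sigma> (int_vec h) \<noteq> int_vec h'"
  shows "\<not> [int_dot (\<sigma> (int_vec h)) z = int_dot (int_vec h') z] (mod int n)"
  using assms by (auto simp: admissible_plan_B_def)

lemma admissible_plan_CD:
  assumes "admissible_plan_C \<Lambda> (n, z)" and "h \<in> \<Lambda>" and "h' \<in> \<Lambda>"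
    and "\<sigma> \<in> sign_changes h" and "h \<noteq> h'"
  shows "\<not> [int_dot (\<sigma> (int_vec h)) z = int_dot (int_vec h') z] (mod int n)"
  using assms by (auto simp: admissible_plan_C_def)

text \<open>Distinct \<open>h\<close> and \<open>h'\<close> stay distinct under every sign change of
  \<open>h\<close>, so each instance of Plan C is an instance of Plan B.\<close>

lemma plan_B_imp_plan_C:
  assumes "admissible_plan_B \<Lambda> (n, z)"
  shows "admissible_plan_C \<Lambda> (n, z)"
  using admissible_plan_BD [OF assms] sign_change_eq_int_vecD
  unfolding admissible_plan_C_def by blast

text \<open>This is Plan B for the pair of \<open>- h\<close> and \<open>h\<close>, whose dot
  products with \<open>z\<close> differ by twice that of \<open>h\<close>.\<close>

lemma plan_B_imp_twice_not_cong_zero: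
  assumes "admissible_plan_B \<Lambda> (n, z)" and "h \<in> \<Lambda>" and "h \<noteq> 0"
  shows "\<not> [2 * int_dot (int_vec h) z = 0] (mod int n)"
proof -
  obtain \<sigma> where \<sigma>: "\<sigma> \<in> sign_changes h" "\<sigma> (int_vec h) = - int_vec h"
    by (rule uminus_sign_change)
  have "- int_vec h \<noteq> int_vec h"
    using \<open>h \<noteq> 0\<close> by (auto simp: int_vec_def vec_eq_iff)
  then have "\<not> [- int_dot (int_vec h) z = int_dot (int_vec h) z] (mod int n)"
    using admissible_plan_BD [OF assms(1,2,2) \<sigma>(1)] \<sigma>(2) by (simp add: int_dot_neg_left)
  then show ?thesis
    by (simp add: cong_iff_dvd_diff)
qed

lemma plan_B_iff_plan_C_twice_not_cong_zero:
  assumes "lower_set \<Lambda>"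
  shows "admissible_plan_B \<Lambda> (n, z) \<longleftrightarrow>
           admissible_plan_C \<Lambda> (n, z) \<and>
           (\<forall>h \<in> \<Lambda> - {0}. \<not> [2 * int_dot (int_vec h) z = 0] (mod int n))"
proof
  assume "admissible_plan_B \<Lambda> (n, z)"
  then show "admissible_plan_C \<Lambda> (n, z) \<and>
           (\<forall>h \<in> \<Lambda> - {0}. \<not> [2 * int_dot (int_vec h) z = 0] (mod int n))"
    using plan_B_imp_plan_C plan_B_imp_twice_not_cong_zero by blast
next
  assume *: "admissible_plan_C \<Lambda> (n, z) \<and>
           (\<forall>h \<in> \<Lambda> - {0}. \<not> [2 * int_dot (int_vec h) z = 0] (mod int n))"
  have "\<not> [int_dot (\<sigma> (int_vec h)) z = int_dot (int_vec h') z] (mod int n)"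
    if h: "h \<in> \<Lambda>" "h' \<in> \<Lambda>" and \<sigma>: "\<sigma> \<in> sign_changes h" "\<sigma> (int_vec h) \<noteq> int_vec h'"
    for h h' \<sigma>
  proof (cases "h = h'")
    case False
    then show ?thesis
      using admissible_plan_CD * h \<sigma> by blast
  next
    case True
    obtain J where J: "J \<subseteq> {i. h $ i \<noteq> 0}" "\<sigma> = sign_change J"
      using \<sigma>(1) by (auto simp: sign_changes_def)
    define k :: "nat ^ 'a" where "k = (\<chi> i. if i \<in> J then h $ i else 0)"
    have "k \<le> h"
      by (simp add: k_def less_eq_vec_def)
    then have "k \<in> \<Lambda>"
      using assms h(1) unfolding lower_set_def by blast
    \<comment> \<open>With \<open>J\<close> empty, \<sigma> would be the identity and would send
      \<open>h\<close> to \<open>h'\<close>.\<close>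
    moreover have "J \<noteq> {}"
      using \<sigma>(2) True J(2) by (auto simp: sign_change_def)
    \<comment> \<open>\<open>J\<close> lies in the support of \<open>h\<close>, so the entries kept
      in \<open>k\<close> are nonzero.\<close>
    then have "k \<noteq> 0"
      using J(1) by (auto simp: k_def vec_eq_iff)
    ultimately have "\<not> [2 * int_dot (int_vec k) z = 0] (mod int n)"
      using * by blast
    then show ?thesis
      by (simp add: J(2) True [symmetric] int_dot_sign_change k_def [symmetric]
          cong_iff_dvd_diff)
  qed
  then show "admissible_plan_B \<Lambda> (n, z)"
    by (simp add: admissible_plan_B_def)
qed

lemma plan_C_imp_twice_not_cong_zero_if_not_extremal:
  assumes "admissible_plan_C \<Lambda> (n, z)" and "k \<in> \<Lambda>" and "k \<notin> extremal_elements \<Lambda>"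
  shows "\<not> [2 * int_dot (int_vec k) z = 0] (mod int n)"
proof -
  obtain a b where ab: "a \<in> \<Lambda>" "b \<in> \<Lambda>" "2 *s k = a + b" and ne: "\<not> (a = k \<and> b = k)"
    using assms(2,3) by (auto simp: extremal_elements_def)
  \<comment> \<open>Plan C speaks only of distinct vectors; equality would give
    \<open>2 *s k = 2 *s a\<close> and hence the excluded trivial decomposition.\<close>
  have "a \<noteq> b"
  proof
    assume "a = b"
    then have "a = k"
      using ab(3) by (simp add: vec_eq_iff mult_2 [symmetric])
    then show False
      using ne \<open>a = b\<close> by simp
  qed
  obtain \<sigma> where \<sigma>: "\<sigma> \<in> sign_changes a" "\<sigma> (int_vec a) = - int_vec a"
    by (rule uminus_sign_change)
  have "\<not> [- int_dot (int_vec a) z = int_dot (int_vec b) z] (mod int n)"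
    using admissible_plan_CD [OF assms(1) ab(1,2) \<sigma>(1) \<open>a \<noteq> b\<close>] \<sigma>(2)
    by (simp add: int_dot_neg_left)
  moreover have "2 * int_dot (int_vec k) z = int_dot (int_vec a) z + int_dot (int_vec b) z"
    by (metis ab(3) int_dot_int_vec_add int_dot_int_vec_twice)
  \<comment> \<open>The two differences to be divided by \<open>n\<close> agree up to sign.\<close>
  ultimately show ?thesis
    by (simp add: cong_iff_dvd_diff)
      (metis dvd_minus_iff minus_add_distrib diff_conv_add_uminus)
qed

lemma plan_C_odd_imp_twice_not_cong_zero:
  assumes "lower_set \<Lambda>" and "admissible_plan_C \<Lambda> (n, z)" and "odd n"
    and "k \<in> \<Lambda>" and "k \<noteq> 0"
  shows "\<not> [2 * int_dot (int_vec k) z = 0] (mod int n)"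
proof -
  \<comment> \<open>Plan C is applied to \<open>k\<close> and \<open>0\<close> with the identity as
    sign change.\<close>
  have "\<not> [int_dot (int_vec k) z = 0] (mod int n)"
    using admissible_plan_CD [OF assms(2,4) lower_set_zero_mem [OF assms(1,4)]
        id_mem_sign_changes assms(5)] by simp
  moreover have "coprime (int n) 2"
    using \<open>odd n\<close> by simp
  ultimately show ?thesis
    by (simp add: cong_0_iff coprime_dvd_mult_right_iff)
qed

theorem proposition4p3:
  fixes \<Lambda> :: "(nat ^ 'd) set" and n :: nat and z :: "int ^ 'd"
  assumes "lower_set \<Lambda>" and "n \<ge> 1"
  shows "(admissible_plan_B \<Lambda> (n, z) \<longleftrightarrow>
            admissible_plan_C \<Lambda> (n, z) \<and>
            (\<forall>h \<in> extremal_elements \<Lambda> - {0}. \<not> [2 * int_dot (int_vec h) z = 0] (mod int n)))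
       \<and> (odd n \<longrightarrow> (admissible_plan_B \<Lambda> (n, z) \<longleftrightarrow> admissible_plan_C \<Lambda> (n, z)))"
proof -
  have "extremal_elements \<Lambda> \<subseteq> \<Lambda>"
    by (auto simp: extremal_elements_def)
  then show ?thesis
    \<comment> \<open>The condition on all nonzero elements splits: extremal ones are covered by the
      assumption and the others by Plan C. For odd \<open>n\<close>, Plan C covers both
      kinds.\<close>
    using plan_B_iff_plan_C_twice_not_cong_zero [OF assms(1)]
      plan_C_imp_twice_not_cong_zero_if_not_extremal
      plan_C_odd_imp_twice_not_cong_zero [OF assms(1)]
    by blast
qed

end
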